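(* Let $A$ be a real $n\times m$ matrix. Whenever the min-max problem $\min_{\mathbf{y}\in\Delta_m}\max_{\mathbf{x}\in\Delta_n}\mathbf{x}^\top A\mathbf{y}$ has a unique optimal solution $(\mathbf{x}^*,\mathbf{y}^* )$, OMWU with an appropriate choice of learning rate and initialized at the pair of uniform distributions $(\tfrac1n\mathbf{1},\tfrac1m\mathbf{1})$ exhibits last-iterate convergence to the optimal solution. That is, if $(\mathbf{x}^t,\mathbf{y}^t)$ are the vectors maintained by OMWU at step $t$, then $$\lim_{t\to\infty}(\mathbf{x}^t,\mathbf{y}^t)=(\mathbf{x}^*,\mathbf{y}^* ).$$
   Context: $\Delta_n\subset\mathbb{R}^n$ and $\Delta_m\subset\mathbb{R}^m$ are the probability simplices, and $\mathbf 1$ is the all-ones vector. An optimal solution of the min-max problem is a pair $(\mathbf{x}^*,\mathbf{y}^* )\in\Delta_n\times\Delta_m$ with $\mathbf{x}^\top A\mathbf{y}^*\le \mathbf{x}^{*\top}A\mathbf{y}^*\le\mathbf{x}^{*\top}A\mathbf{y}$ for all $\mathbf{x}\in\Delta_n$, $\mathbf{y}\in\Delta_m$ (a minimax/Nash equilibrium). Optimistic Multiplicative-Weights Update (OMWU) with learning rate (stepsize) $\eta$, $0<\eta<1$: given initial points $(\mathbf{x}^1,\mathbf{y}^1),(\mathbf{x}^0,\mathbf{y}^0)\in\Delta_n\times\Delta_m$, for $t\ge1$, $$x_i^{t+1}=x_i^t\,\frac{e^{2\eta(A\mathbf{y}^t)_i-\eta(A\mathbf{y}^{t-1})_i}}{\sum_{j=1}^n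 x_j^t e^{2\eta(A\mathbf{y}^t)_j-\eta(A\mathbf{y}^{t-1})_j}}\ (i\in[n]),\qquad y_i^{t+1}=y_i^t\,\frac{e^{-2\eta(A^\top\mathbf{x}^t)_i+\eta(A^\top\mathbf{x}^{t-1})_i}}{\sum_{j=1}^m y_j^t e^{-2\eta(A^\top\mathbf{x}^t)_j+\eta(A^\top\mathbf{x}^{t-1})_j}}\ (i\in[m]).$$ Initialization at the uniform distributions means $(\mathbf{x}^1,\mathbf{y}^1)=(\mathbf{x}^0,\mathbf{y}^0)=(\tfrac1n\mathbf{1},\tfrac1m\mathbf{1})$. Regarding the choice of learning rate: it is sufficiently small (depending on $n,m,A$) and does not vanish with time; the run has two phases, in each of which the learning rate is constant, but its value may change when passing from the first phase to the second. *)

theory Defs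
  imports "HOL-Analysis.Analysis"
begin

definition prob_simplex :: "(real ^ 'k) set" where
  "prob_simplex = {x. (\<forall>i. 0 \<le> x $ i) \<and> (\<Sum>i\<in>UNIV. x $ i) = 1}"

definition uniform_dist :: "real ^ 'k" where
  "uniform_dist = (\<chi> i. 1 / real CARD('k))"

definition optimal_solution :: "real ^ 'm ^ 'n \<Rightarrow> (real ^ 'n) \<times> (real ^ 'm) \<Rightarrow> bool" where
  "optimal_solution A z \<longleftrightarrow>
     (case z of (xs, ys) \<Rightarrow>
        xs \<in> prob_simplex \<and> ys \<in> prob_simplex \<and>
        (\<forall>x \<in> prob_simplex. \<forall>y \<in> prob_simplex.
           x \<bullet> (A *v ys) \<le> xs \<bullet> (A *v ys) \<and> xs \<bullet> (A *v ys) \<le> xs \<bullet> (A *v y)))"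

text \<open>In the update functions the primed arguments are the iterates of the previous step.\<close>

definition omwu_x :: "real \<Rightarrow> real ^ 'm ^ 'n \<Rightarrow> real ^ 'n \<Rightarrow> real ^ 'm \<Rightarrow> real ^ 'm \<Rightarrow> real ^ 'n" where
  "omwu_x \<eta> A x y y' =
     (\<chi> i. x $ i * (exp (2 * \<eta> * (A *v y) $ i - \<eta> * (A *v y') $ i) /
        (\<Sum>j\<in>UNIV. x $ j * exp (2 * \<eta> * (A *v y) $ j - \<eta> * (A *v y') $ j))))"

definition omwu_y :: "real \<Rightarrow> real ^ 'm ^ 'n \<Rightarrow> real ^ 'm \<Rightarrow> real ^ 'n \<Rightarrow> real ^ 'n \<Rightarrow> real ^ 'm" where
  "omwu_y \<eta> A y x x' =
     (\<chi> i. y $ i * (exp (- 2 * \<eta> * (transpose A *v x) $ i + \<eta> * (transpose A *v x') $ i) /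
        (\<Sum>j\<in>UNIV. y $ j * exp (- 2 * \<eta> * (transpose A *v x) $ j + \<eta> * (transpose A *v x') $ j))))"

text \<open>The step from time \<open>t\<close> to time \<open>t + 1\<close>, for \<open>t \<ge> 1\<close>, uses the learning rate \<open>\<eta> t\<close>.\<close>

fun omwu :: "(nat \<Rightarrow> real) \<Rightarrow> real ^ 'm ^ 'n \<Rightarrow> (real ^ 'n) \<times> (real ^ 'm) \<Rightarrow>
    (real ^ 'n) \<times> (real ^ 'm) \<Rightarrow> nat \<Rightarrow> (real ^ 'n) \<times> (real ^ 'm)" where
  "omwu \<eta> A z0 z1 0 = z0"
| "omwu \<eta> A z0 z1 (Suc 0) = z1"
| "omwu \<eta> A z0 z1 (Suc (Suc t)) =
     (let (x, y) = omwu \<eta> A z0 z1 (Suc t);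
          (x', y') = omwu \<eta> A z0 z1 t
      in (omwu_x (\<eta> (Suc t)) A x y y', omwu_y (\<eta> (Suc t)) A y x x'))"

definition two_phase :: "nat \<Rightarrow> real \<Rightarrow> real \<Rightarrow> nat \<Rightarrow> real" where
  "two_phase T \<eta>1 \<eta>2 t = (if t \<le> T then \<eta>1 else \<eta>2)"

end

theory Submission
  imports Defs
begin

text \<open>OMWU is optimistic mirror descent for the entropy: there are anchors \<open>U, V\<close> such that the
  iterate is a multiplicative-weights step from the anchor along the previous gradient, and the next
  anchor is such a step along the current gradient. For small stepsizes the potential
  \<open>KL(z*, anchor) + KL(anchor, previous iterate) / 2\<close> decreases by at least a fixed fraction of the
  divergences between consecutive anchors and iterates, so these tend to \<open>0\<close> while
  \<open>KL(z*, anchor)\<close> stays bounded. Hence every limit point is a fixed point of multiplicative weights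
  whose support contains that of the equilibrium \<open>z*\<close>. The payoffs are constant on the support of
  such a point; together with strict complementarity (a consequence of uniqueness) this forces it to
  be \<open>z*\<close>. The argument works from any positive starting points, so a first phase of a single step
  with an arbitrary learning rate suffices.\<close>

section \<open>Multiplicative weights and relative entropy\<close>

definition pos_simplex :: "(real ^ 'k) set" where
  "pos_simplex = {x. (\<forall>i. 0 < x $ i) \<and> (\<Sum>i\<in>UNIV. x $ i) = 1}"

text \<open>The entropic mirror ascent step: for positive \<open>p\<close>, \<open>mw p g\<close>
  maximises \<open>g \<bullet> q - kl q p\<close> over \<open>q\<close> in the simplex.\<close>

definition mw :: "real ^ 'k \<Rightarrow> real ^ 'k \<Rightarrow> real ^ 'k" where
  "mw p g = (\<chi> i. p $ i * exp (g $ i) / (\<Sum>j\<in>UNIV. p $ j * exp (g $ j)))"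

text \<open>Kullback-Leibler divergence on the simplex. A zero coordinate of \<open>p\<close>
  contributes 0, so the first argument may lie on the boundary, as the equilibrium may.\<close>

definition kl :: "real ^ 'k \<Rightarrow> real ^ 'k \<Rightarrow> real" where
  "kl p q = (\<Sum>i\<in>UNIV. p $ i * (ln (p $ i) - ln (q $ i)))"

lemma pos_simplex_subset: "p \<in> pos_simplex \<Longrightarrow> p \<in> prob_simplex"
  by (auto simp: pos_simplex_def prob_simplex_def less_imp_le)

lemma prob_simplex_le_1:
  assumes "p \<in> prob_simplex" shows "p $ i \<le> 1"
  using assms member_le_sum[of i UNIV "\<lambda>i. p $ i"] by (auto simp: prob_simplex_def)

lemma mw_denominator_pos:
  assumes "p \<in> prob_simplex" shows "0 < (\<Sum>j\<in>UNIV. p $ j * exp (g $ j))"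
proof -
  have "\<not> (\<forall>j. p $ j \<le> 0)"
    using assms sum_nonpos[of UNIV "\<lambda>j. p $ j"] by (auto simp: prob_simplex_def)
  then obtain j where "0 < p $ j" by (auto simp: not_le)
  then show ?thesis
    using assms by (intro sum_pos2[of _ j]) (auto simp: prob_simplex_def)
qed

lemma mw_pos_simplex:
  assumes "p \<in> pos_simplex" shows "mw p g \<in> pos_simplex"
proof -
  note Z = mw_denominator_pos[OF pos_simplex_subset[OF assms], of g]
  with assms show ?thesis
    by (auto simp: pos_simplex_def mw_def sum_divide_distrib[symmetric])
qed

text \<open>Normalising constants cancel, so exponents add. Hence a step can be undone, and the
  exponent of OMWU can be split at the anchors.\<close>

lemma mw_mw:
  assumes "p \<in> pos_simplex" shows "mw (mw p g) h = mw p (g + h)"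
proof -
  define Z where "Z = (\<Sum>j\<in>UNIV. p $ j * exp (g $ j))"
  have Z: "0 < Z" unfolding Z_def by (rule mw_denominator_pos[OF pos_simplex_subset[OF assms]])
  have *: "mw p g $ j * exp (h $ j) = p $ j * exp ((g + h) $ j) / Z" for j
    by (simp add: mw_def Z_def exp_add)
  show ?thesis
    using Z by (subst mw_def) (simp add: * mw_def[of p "g + h"] sum_divide_distrib[symmetric])
qed

lemma mw_0:
  assumes "p \<in> pos_simplex" shows "mw p 0 = p"
  using assms by (simp add: mw_def pos_simplex_def vec_eq_iff)

text \<open>The logarithms of \<open>mw p g\<close> and \<open>p\<close> differ by \<open>g\<close>
  up to the constant \<open>ln Z\<close>, and constants vanish against \<open>u - mw p g\<close>,
  whose coordinates sum to 0.\<close>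

lemma mw_three_point:
  assumes p: "p \<in> pos_simplex" and u: "(\<Sum>i\<in>UNIV. u $ i) = 1"
  shows "g \<bullet> (u - mw p g) = kl u p - kl u (mw p g) - kl (mw p g) p"
proof -
  define Z where "Z = (\<Sum>j\<in>UNIV. p $ j * exp (g $ j))"
  define q where "q = mw p g"
  have Z: "0 < Z" unfolding Z_def by (rule mw_denominator_pos[OF pos_simplex_subset[OF p]])
  have q: "q \<in> pos_simplex" unfolding q_def by (rule mw_pos_simplex[OF p])
  have lnq: "ln (q $ i) = ln (p $ i) + g $ i - ln Z" for i
    using p Z less_imp_neq[of 0 "p $ i"]
    by (simp add: q_def mw_def Z_def[symmetric] pos_simplex_def ln_mult ln_div)
  have "kl u p - kl u q - kl q p = (\<Sum>i\<in>UNIV. (u $ i - q $ i) * (g $ i - ln Z))"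
    unfolding kl_def sum_subtractf[symmetric] by (intro sum.cong) (auto simp: lnq algebra_simps)
  also have "\<dots> = (\<Sum>i\<in>UNIV. g $ i * (u $ i - q $ i)) - ln Z * ((\<Sum>i\<in>UNIV. u $ i) - (\<Sum>i\<in>UNIV. q $ i))"
    by (simp add: algebra_simps sum_subtractf sum.distrib sum_distrib_left)
  also have "\<dots> = g \<bullet> (u - q)"
    using u q by (simp add: pos_simplex_def inner_vec_def)
  finally show ?thesis by (simp add: q_def)
qed

text \<open>With \<open>s\<close>, \<open>r\<close> the square roots of \<open>p\<close>,
  \<open>q\<close>, the inequality \<open>ln z \<le> z - 1\<close> at \<open>z = r / s\<close>
  bounds the right side below by the Hellinger term \<open>(s - r)\<^sup>2\<close>; then
  \<open>s + r \<le> 2\<close> yields the factor 1/4.\<close>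

lemma entropy_term_ge:
  fixes p q :: real
  assumes p: "0 \<le> p" "p \<le> 1" and q: "0 < q" "q \<le> 1"
  shows "(p - q)\<^sup>2 / 4 \<le> p * (ln p - ln q) - p + q"
proof (cases "p = 0")
  case True
  then show ?thesis
    using q mult_left_le[of q q] by (simp add: power2_eq_square)
next
  case False
  with p have p0: "0 < p" by simp
  define s where "s = sqrt p"
  define r where "r = sqrt q"
  have s: "0 < s" "s \<le> 1" "p = s\<^sup>2" and r: "0 < r" "r \<le> 1" "q = r\<^sup>2"
    using p0 p q by (auto simp: s_def r_def)
  have "ln (r / s) \<le> r / s - 1" using s r by (intro ln_le_minus_one) auto
  then have "s\<^sup>2 * (2 * (ln s - ln r)) \<ge> s\<^sup>2 * (2 * (1 - r / s))"
    using s r by (intro mult_left_mono) (auto simp: ln_div)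
  also have "s\<^sup>2 * (2 * (1 - r / s)) = 2 * s\<^sup>2 - 2 * s * r"
    using s by (simp add: field_simps power2_eq_square)
  finally have *: "(s - r)\<^sup>2 \<le> p * (ln p - ln q) - p + q"
    using s r by (simp add: ln_realpow power2_diff algebra_simps)
  have "(s + r)\<^sup>2 \<le> 2\<^sup>2" using s r by (intro power_mono) auto
  then have "(s - r)\<^sup>2 * (s + r)\<^sup>2 \<le> (s - r)\<^sup>2 * 4"
    by (intro mult_left_mono) auto
  moreover have "(p - q)\<^sup>2 = (s - r)\<^sup>2 * (s + r)\<^sup>2"
    using s r by (simp add: power2_eq_square algebra_simps)
  ultimately show ?thesis using * by simp
qed

text \<open>A weak Pinsker inequality: in the sum of the coordinatewise bounds the linear terms
  cancel, because both vectors have mass 1.\<close>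

lemma kl_ge_norm:
  assumes p: "p \<in> prob_simplex" and q: "q \<in> pos_simplex"
  shows "(norm (p - q))\<^sup>2 / 4 \<le> kl p q"
proof -
  have "(norm (p - q))\<^sup>2 / 4 = (\<Sum>i\<in>UNIV. (p $ i - q $ i)\<^sup>2 / 4)"
    unfolding power2_norm_eq_inner inner_vec_def sum_divide_distrib by (simp add: power2_eq_square)
  also have "\<dots> \<le> (\<Sum>i\<in>UNIV. p $ i * (ln (p $ i) - ln (q $ i)) - p $ i + q $ i)"
    using p q prob_simplex_le_1[OF p] prob_simplex_le_1[OF pos_simplex_subset[OF q]]
    by (intro sum_mono entropy_term_ge) (auto simp: prob_simplex_def pos_simplex_def)
  also have "\<dots> = kl p q"
    using p q by (simp add: kl_def sum.distrib sum_subtractf prob_simplex_def pos_simplex_def)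
  finally show ?thesis .
qed

lemma mw_fixed_point:
  assumes p: "p \<in> prob_simplex" and fp: "mw p g = p"
  shows "\<exists>c. \<forall>i. 0 < p $ i \<longrightarrow> g $ i = c"
proof -
  define Z where "Z = (\<Sum>j\<in>UNIV. p $ j * exp (g $ j))"
  have Z: "0 < Z" unfolding Z_def by (rule mw_denominator_pos[OF p])
  have "g $ i = ln Z" if "0 < p $ i" for i
  proof -
    have "p $ i * exp (g $ i) / Z = p $ i" using fp by (simp add: mw_def Z_def vec_eq_iff)
    then have "exp (g $ i) = Z" using that Z by (simp add: field_simps)
    then show ?thesis by (metis ln_exp)
  qed
  then show ?thesis by blast
qed

text \<open>One step of optimistic mirror descent: \<open>p\<close> is the anchor, \<open>q\<close> the played point obtained from
  the predicted gradient \<open>h\<close>, and \<open>r\<close> the next anchor obtained from the true gradient \<open>g\<close>.\<close>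

lemma optimistic_step:
  assumes p: "p \<in> pos_simplex" and u: "u \<in> prob_simplex"
    and q: "q = mw p h" and r: "r = mw p g"
  shows "kl u r = kl u p - kl r q - kl q p - g \<bullet> (u - q) + (g - h) \<bullet> (r - q)"
proof -
  have "r \<in> pos_simplex" unfolding r by (rule mw_pos_simplex[OF p])
  then have "(\<Sum>i\<in>UNIV. r $ i) = 1" by (simp add: pos_simplex_def)
  \<comment> \<open>The three-point identity is used for both mirror steps from \<open>p\<close>,
    compared with \<open>r\<close> and with \<open>u\<close>; adding the two cancels
    \<open>kl r p\<close>.\<close>
  then have "h \<bullet> (r - q) = kl r p - kl r q - kl q p"
    unfolding q by (rule mw_three_point[OF p])
  moreover have "g \<bullet> (u - r) = kl u p - kl u r - kl r p"
    unfolding r using u by (intro mw_three_point[OF p]) (simp add: prob_simplex_def)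
  ultimately show ?thesis by (simp add: inner_simps)
qed

section \<open>Zero-sum games: optimality, strict complementarity, uniqueness\<close>

lemma inner_matrix_transpose:
  fixes A :: "real ^ 'm ^ 'n"
  shows "x \<bullet> (A *v y) = y \<bullet> (transpose A *v x)"
  by (simp add: dot_lmul_matrix[symmetric] inner_commute)

lemma simplex_inner_le:
  assumes "x \<in> prob_simplex" "\<And>i. g $ i \<le> v" shows "x \<bullet> g \<le> v"
proof -
  have "x \<bullet> g \<le> (\<Sum>i\<in>UNIV. x $ i * v)"
    using assms by (auto simp: inner_vec_def prob_simplex_def intro!: sum_mono mult_left_mono)
  then show ?thesis using assms by (simp add: sum_distrib_right[symmetric] prob_simplex_def)
qed

lemma simplex_inner_ge:
  assumes "x \<in> prob_simplex" "\<And>i. v \<le> g $ i" shows "v \<le> x \<bullet> g"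
  using simplex_inner_le[of x "- g" "- v"] assms by simp

lemma simplex_inner_eq:
  assumes "x \<in> prob_simplex" "\<And>i. 0 < x $ i \<Longrightarrow> g $ i = v" shows "x \<bullet> g = v"
proof -
  have "x $ i * g $ i = x $ i * v" for i
    using assms by (cases "x $ i = 0") (auto simp: prob_simplex_def order.strict_iff_order)
  then have "x \<bullet> g = (\<Sum>i\<in>UNIV. x $ i * v)"
    unfolding inner_vec_def inner_real_def by (intro sum.cong refl)
  then show ?thesis using assms by (simp add: sum_distrib_right[symmetric] prob_simplex_def)
qed

lemma axis_prob_simplex: "axis i 1 \<in> prob_simplex"
  by (simp add: prob_simplex_def axis_def)

text \<open>Payoff bounds for pure strategies extend to mixed ones by averaging, so a threshold
  \<open>v\<close> separating the two families of payoffs certifies a saddle point.\<close>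

lemma optimal_solutionI:
  assumes x: "x \<in> prob_simplex" and y: "y \<in> prob_simplex"
    and "\<And>i. (A *v y) $ i \<le> v" and "\<And>j. v \<le> (transpose A *v x) $ j"
  shows "optimal_solution A (x, y)"
proof -
  have 1: "x' \<bullet> (A *v y) \<le> v" if "x' \<in> prob_simplex" for x'
    using that assms(3) by (rule simplex_inner_le)
  have 2: "v \<le> x \<bullet> (A *v y')" if "y' \<in> prob_simplex" for y'
    using that assms(4) by (subst inner_matrix_transpose) (rule simplex_inner_ge)
  show ?thesis
    unfolding optimal_solution_def using x y order_trans[OF 1 2[OF y]] order_trans[OF 1[OF x] 2]
    by simp
qed

lemma optimal_solutionD:
  assumes "optimal_solution A (x, y)"
  shows "x \<in> prob_simplex" "y \<in> prob_simplex"
    "(A *v y) $ i \<le> x \<bullet> (A *v y)" "x \<bullet> (A *v y) \<le> (transpose A *v x) $ j"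
proof -
  show x: "x \<in> prob_simplex" and y: "y \<in> prob_simplex"
    using assms by (auto simp: optimal_solution_def)
  have "axis i 1 \<bullet> (A *v y) \<le> x \<bullet> (A *v y)"
    using assms y axis_prob_simplex[of i] unfolding optimal_solution_def by blast
  then show "(A *v y) $ i \<le> x \<bullet> (A *v y)" by (simp add: inner_axis')
  have "x \<bullet> (A *v y) \<le> x \<bullet> (A *v axis j 1)"
    using assms x axis_prob_simplex[of j] unfolding optimal_solution_def by blast
  then show "x \<bullet> (A *v y) \<le> (transpose A *v x) $ j"
    by (simp add: inner_matrix_transpose[of x A "axis j 1"] inner_axis')
qed

lemma uminus_matrix_vector_mult:
  fixes A :: "real ^ 'm ^ 'n"
  shows "(- A) *v x = - (A *v x)"
  by (simp add: matrix_vector_mult_def vec_eq_iff sum_negf)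

lemma transpose_uminus: "transpose (- A) = - transpose (A :: real ^ 'm ^ 'n)"
  by (simp add: transpose_def vec_eq_iff)

text \<open>Exchange of the players, used to transfer results on the row player to the column
  player. One implication, for all dimensions, is enough because the exchange is an
  involution.\<close>

lemma optimal_solution_transpose:
  fixes A :: "real ^ 'm ^ 'n"
  shows "optimal_solution (- transpose A) (y, x) \<longleftrightarrow> optimal_solution A (x, y)"
proof -
  have "optimal_solution (- transpose A) (y, x)" if "optimal_solution A (x, y)"
    for A :: "real ^ 'p ^ 'q" and x y
    using optimal_solutionD[OF that]
    by (intro optimal_solutionI[where v = "- (x \<bullet> (A *v y))"])
       (auto simp: uminus_matrix_vector_mult transpose_uminus)
  from this[of A x y] this[of "- transpose A" y x] show ?thesis
    by (auto simp: transpose_uminus)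
qed

text \<open>Decided by whether \<open>- axis i 1\<close> lies in the cone generated by the columns
  of \<open>M\<close> and the coordinate axes: its coefficients there give \<open>dual\<close>, a
  separating hyperplane gives \<open>primal\<close>.\<close>

lemma farkas_alternative:
  fixes M :: "real ^ 'm ^ 'n"
  obtains (primal) x where "\<And>k. 0 \<le> x $ k" "\<And>j. 0 \<le> (transpose M *v x) $ j" "0 < x $ i"
  | (dual) y where "\<And>j. 0 \<le> y $ j" "\<And>k. (M *v y) $ k \<le> 0" "(M *v y) $ i < 0"
proof -
  \<comment> \<open>\<open>K\<close> is finitely generated, hence closed, as separation requires;
    \<open>K'\<close> makes the coefficients explicit.\<close>
  define G where "G = range (\<lambda>j. column j M) \<union> range (\<lambda>k. axis k (1::real))"
  define K where "K = convex_cone hull G"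
  define K' where "K' = {M *v y + u | y u. (\<forall>j. 0 \<le> y $ j) \<and> (\<forall>k. 0 \<le> u $ k)}"
  have K: "closed K" "convex_cone K"
    unfolding K_def G_def by (auto intro: closed_convex_cone_hull convex_cone_convex_cone_hull)
  have K'I: "M *v y + u \<in> K'" if "\<forall>j. 0 \<le> y $ j" "\<forall>k. 0 \<le> u $ k" for y u
    using that unfolding K'_def by blast
  have "convex_cone K'"
    unfolding convex_cone_iff
  proof (intro conjI ballI allI impI)
    show "0 \<in> K'" using K'I[of 0 0] by simp
    fix w assume "w \<in> K'"
    then obtain y u where w: "w = M *v y + u" and yu: "\<forall>j. 0 \<le> y $ j" "\<forall>k. 0 \<le> u $ k"
      unfolding K'_def by blast
    show "c *\<^sub>R w \<in> K'" if "0 \<le> c" for c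
      using K'I[of "c *\<^sub>R y" "c *\<^sub>R u"] yu that
      by (simp add: w scaleR_add_right matrix_vector_mult_scaleR)
    fix w' assume "w' \<in> K'"
    then obtain y' u' where w': "w' = M *v y' + u'" and yu': "\<forall>j. 0 \<le> y' $ j" "\<forall>k. 0 \<le> u' $ k"
      unfolding K'_def by blast
    show "w + w' \<in> K'"
      using K'I[of "y + y'" "u + u'"] yu yu'
      by (simp add: w w' matrix_vector_right_distrib algebra_simps)
  qed
  moreover have "G \<subseteq> K'"
  proof -
    have "column j M \<in> K'" for j
      using K'I[of "axis j 1" 0] axis_prob_simplex[of j]
      by (simp add: matrix_vector_mult_basis prob_simplex_def)
    moreover have "axis k 1 \<in> K'" for k
      using K'I[of 0 "axis k 1"] by (simp add: axis_def)
    ultimately show ?thesis by (auto simp: G_def)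
  qed
  ultimately have KK': "K \<subseteq> K'"
    unfolding K_def by (metis hull_minimal)
  show thesis
  proof (cases "- axis i 1 \<in> K")
    case True
    then obtain y u where y: "\<forall>j. 0 \<le> y $ j" and u: "\<forall>k. 0 \<le> u $ k"
      and eq: "- axis i 1 = M *v y + u"
      using KK' unfolding K'_def by blast
    have "(M *v y) $ k = - (axis i 1 $ k) - u $ k" for k
      using arg_cong[OF eq, of "\<lambda>w. w $ k"] by simp
    moreover have "- 1 < u $ i" using u by (meson less_le_trans neg_less_0_iff_less zero_less_one)
    ultimately show thesis
      using u y by (intro dual[of y]) (auto simp: axis_def less_imp_le)
  next
    case False
    from K(2) have "convex K" by (simp add: convex_cone_def)
    from separating_hyperplane_closed_point[OF this K(1) False]
    obtain a b where ab: "a \<bullet> (- axis i 1) < b" "\<And>w. w \<in> K \<Longrightarrow> b < a \<bullet> w" by blast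
    have "0 \<in> K" using K(2) convex_cone_contains_0 by blast
    then have b: "b < 0" using ab(2)[of 0] by simp
    \<comment> \<open>If \<open>a \<bullet> w\<close> were negative, scaling \<open>w\<close> by the
      positive number \<open>b / (a \<bullet> w)\<close> would give a point of \<open>K\<close> with
      inner product exactly \<open>b\<close>, against strict separation.\<close>
    have ge: "0 \<le> a \<bullet> w" if "w \<in> G" for w
    proof (rule ccontr)
      assume neg: "\<not> 0 \<le> a \<bullet> w"
      have "w \<in> K" unfolding K_def using that by (rule hull_inc)
      then have "(b / (a \<bullet> w)) *\<^sub>R w \<in> K"
        using K(2) b neg by (intro convex_cone_scaleR) (auto simp: zero_le_divide_iff)
      from ab(2)[OF this] neg show False by simp
    qed
    show thesis
    proof (rule primal[of a])
      show "0 \<le> a $ k" for k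
        using ge[of "axis k 1"] by (simp add: G_def inner_axis)
      show "0 \<le> (transpose M *v a) $ j" for j
        using ge[of "column j M"]
        by (simp add: G_def matrix_vector_mul_component row_transpose inner_commute
            row_def[symmetric] transpose_def column_def inner_vec_def mult.commute)
      show "0 < a $ i" using ab(1) b by (simp add: inner_axis)
    qed
  qed
qed


lemma normalize_prob_simplex:
  assumes "\<And>k. 0 \<le> x $ k" and "0 < (\<Sum>k\<in>UNIV. x $ k)"
  shows "(1 / (\<Sum>k\<in>UNIV. x $ k)) *\<^sub>R x \<in> prob_simplex"
  using assms by (auto simp: prob_simplex_def sum_divide_distrib[symmetric])

lemma shifted_matrix_vector_mult:
  fixes A :: "real ^ 'm ^ 'n"
  shows "((\<chi> k j. A $ k $ j - v) *v y) $ k = (A *v y) $ k - v * (\<Sum>j\<in>UNIV. y $ j)"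
  by (simp add: matrix_vector_mult_def left_diff_distrib sum_subtractf sum_distrib_left)

text \<open>The Goldman--Tucker argument: normalising either alternative of Farkas' lemma gives an
  equilibrium strategy, which by uniqueness is the given one.\<close>

lemma strict_complementarity:
  assumes uniq: "\<And>z. optimal_solution A z \<Longrightarrow> z = (xs, ys)"
    and opt: "optimal_solution A (xs, ys)" and zero: "xs $ i = 0"
  shows "(A *v ys) $ i < xs \<bullet> (A *v ys)"
proof -
  define v where "v = xs \<bullet> (A *v ys)"
  \<comment> \<open>Subtracting the value makes optimality homogeneous: sign conditions on products
    with \<open>M\<close> become, after normalisation, comparisons with \<open>v\<close>.\<close>
  define M where "M = (\<chi> k j. A $ k $ j - v)"
  note D = optimal_solutionD[OF opt, folded v_def]
  have M: "(M *v y) $ k = (A *v y) $ k - v * (\<Sum>j\<in>UNIV. y $ j)" for y k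
    unfolding M_def by (rule shifted_matrix_vector_mult)
  have "transpose M = (\<chi> k j. transpose A $ k $ j - v)"
    by (simp add: M_def transpose_def vec_eq_iff)
  then have MT: "(transpose M *v x) $ j = (transpose A *v x) $ j - v * (\<Sum>k\<in>UNIV. x $ k)" for x j
    by (simp add: shifted_matrix_vector_mult)
  show ?thesis unfolding v_def[symmetric]
  proof (rule farkas_alternative[of M i])
    \<comment> \<open>This alternative is contradictory: the normalised \<open>x\<close> is optimal,
      hence equal to \<open>xs\<close>, yet it is positive at \<open>i\<close>.\<close>
    fix x assume x: "\<And>k. 0 \<le> x $ k" "\<And>j. 0 \<le> (transpose M *v x) $ j" "0 < x $ i"
    define s where "s = (\<Sum>k\<in>UNIV. x $ k)"
    have s: "0 < s" unfolding s_def using x by (intro sum_pos2[of _ i]) auto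
    have "optimal_solution A ((1 / s) *\<^sub>R x, ys)"
    proof (rule optimal_solutionI[OF _ D(2,3)])
      show "(1 / s) *\<^sub>R x \<in> prob_simplex"
        unfolding s_def using x s by (intro normalize_prob_simplex) (auto simp: s_def)
      show "v \<le> (transpose A *v ((1 / s) *\<^sub>R x)) $ j" for j
        using x(2)[of j] s
        by (simp add: MT s_def[symmetric] matrix_vector_mult_scaleR field_simps del: transpose_matrix_vector)
    qed
    from uniq[OF this] have "(1 / s) *\<^sub>R x = xs" by simp
    with zero x(3) s show "(A *v ys) $ i < v" by auto
  next
    \<comment> \<open>Here the normalised \<open>y\<close> is optimal, hence equal to
      \<open>ys\<close>, and it carries the strict inequality at \<open>i\<close>.\<close>
    fix y assume y: "\<And>j. 0 \<le> y $ j" "\<And>k. (M *v y) $ k \<le> 0" "(M *v y) $ i < 0"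
    define s where "s = (\<Sum>k\<in>UNIV. y $ k)"
    have s: "0 < s"
    proof -
      have "s \<noteq> 0"
      proof
        assume "s = 0"
        then have "y = 0" unfolding s_def using y(1) by (subst (asm) sum_nonneg_eq_0_iff) (auto simp: vec_eq_iff)
        with y(3) show False by simp
      qed
      moreover have "0 \<le> s" unfolding s_def using y(1) by (intro sum_nonneg)
      ultimately show ?thesis by simp
    qed
    have *: "optimal_solution A (xs, (1 / s) *\<^sub>R y)"
    proof (rule optimal_solutionI[OF D(1) _ _ D(4)])
      show "(1 / s) *\<^sub>R y \<in> prob_simplex"
        unfolding s_def using y s by (intro normalize_prob_simplex) (auto simp: s_def)
      show "(A *v ((1 / s) *\<^sub>R y)) $ k \<le> v" for k
        using y(2)[of k] s by (simp add: M s_def[symmetric] matrix_vector_mult_scaleR field_simps)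
    qed
    from uniq[OF *] have "(1 / s) *\<^sub>R y = ys" by simp
    moreover have "(A *v ((1 / s) *\<^sub>R y)) $ i < v"
      using y(3) s by (simp add: M s_def[symmetric] matrix_vector_mult_scaleR field_simps)
    ultimately show "(A *v ys) $ i < v" by simp
  qed
qed

lemma unique_optimal_transpose:
  assumes "\<And>z. optimal_solution A z \<Longrightarrow> z = (xs, ys)"
  shows "optimal_solution (- transpose A) z \<Longrightarrow> z = (ys, xs)"
  using assms[of "(snd z, fst z)"] optimal_solution_transpose[of A "fst z" "snd z"]
  by (auto simp: prod_eq_iff)

text \<open>Because the supports contain those of the equilibrium, the constant payoffs equal the
  game value. So \<open>x\<close> ties on the support of \<open>ys\<close>, while \<open>xs\<close>
  has slack off it; a small mixture of both is then optimal against \<open>ys\<close>, and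
  uniqueness applies.\<close>

lemma equalizing_pair_eq_fst:
  fixes A :: "real ^ 'm ^ 'n"
  assumes uniq: "\<And>z. optimal_solution A z \<Longrightarrow> z = (xs, ys)"
    and opt: "optimal_solution A (xs, ys)"
    and x: "x \<in> prob_simplex" and y: "y \<in> prob_simplex"
    and c: "\<And>i. 0 < x $ i \<Longrightarrow> (A *v y) $ i = c"
    and d: "\<And>j. 0 < y $ j \<Longrightarrow> (transpose A *v x) $ j = d"
    and suppx: "\<And>i. 0 < xs $ i \<Longrightarrow> 0 < x $ i"
    and suppy: "\<And>j. 0 < ys $ j \<Longrightarrow> 0 < y $ j"
  shows "x = xs"
proof -
  define v where "v = xs \<bullet> (A *v ys)"
  note D = optimal_solutionD[OF opt, folded v_def]
  \<comment> \<open>The chain is \<open>c = x \<bullet> (A *v y) = d\<close> together with \<open>d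
    = x \<bullet> (A *v ys) \<le> v \<le> xs \<bullet> (A *v y) = c\<close>.\<close>
  have "x \<bullet> (A *v y) = c" using x c by (rule simplex_inner_eq)
  moreover have "x \<bullet> (A *v y) = d"
    using y d by (subst inner_matrix_transpose) (rule simplex_inner_eq)
  moreover have "xs \<bullet> (A *v y) = c" using D(1) c suppx by (intro simplex_inner_eq) auto
  moreover have "x \<bullet> (A *v ys) = d"
    using D(2) d suppy by (subst inner_matrix_transpose, intro simplex_inner_eq) auto
  moreover have "v \<le> xs \<bullet> (A *v y)"
    using y D(4) by (subst inner_matrix_transpose) (rule simplex_inner_ge)
  moreover have "x \<bullet> (A *v ys) \<le> v" using x D(3) by (rule simplex_inner_le)
  ultimately have dv: "d = v" by linarith
  \<comment> \<open>Moving slightly from \<open>xs\<close> towards \<open>x\<close> preserves optimality.\<close>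
  define w where "w = (\<lambda>e. (1 - e) *\<^sub>R xs + e *\<^sub>R x)"
  have Aw: "(transpose A *v w e) $ j = (1 - e) * (transpose A *v xs) $ j + e * (transpose A *v x) $ j" for e j
    by (simp add: w_def matrix_vector_right_distrib matrix_vector_mult_scaleR)
  have "\<forall>\<^sub>F e in at_right 0. v \<le> (transpose A *v w e) $ j" for j
  proof (cases "0 < ys $ j")
    case True
    then have "(transpose A *v x) $ j = v" using d suppy dv by blast
    then have "v \<le> (transpose A *v w e) $ j" if "e < 1" for e
      using mult_left_mono[OF D(4)[of j], of "1 - e"] that
      by (simp add: Aw algebra_simps del: transpose_matrix_vector)
    then show ?thesis
      by (auto simp: eventually_at_right_field intro!: exI[of _ 1])
  next
    case False
    \<comment> \<open>Off the support of \<open>ys\<close>, strict complementarity for the column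
      player makes the inequality strict at \<open>e = 0\<close>, so it survives for small
      \<open>e\<close> by continuity.\<close>
    then have "ys $ j = 0" using D(2) by (force simp: prob_simplex_def not_less intro: antisym)
    moreover have "optimal_solution (- transpose A) (ys, xs)" using opt by (simp add: optimal_solution_transpose)
    ultimately have "((- transpose A) *v xs) $ j < ys \<bullet> ((- transpose A) *v xs)"
      using unique_optimal_transpose[OF uniq] by (intro strict_complementarity)
    then have "v < (transpose A *v xs) $ j"
      by (simp add: uminus_matrix_vector_mult v_def inner_matrix_transpose[of xs])
    moreover have "((\<lambda>e. (transpose A *v w e) $ j) \<longlongrightarrow> (transpose A *v xs) $ j) (at_right 0)"
      unfolding Aw by (auto intro!: tendsto_eq_intros)
    ultimately have "\<forall>\<^sub>F e in at_right 0. v < (transpose A *v w e) $ j"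
      by (rule order_tendstoD(1)[rotated])
    then show ?thesis by (rule eventually_mono) simp
  qed
  then have "\<forall>\<^sub>F e in at_right 0. \<forall>j. v \<le> (transpose A *v w e) $ j"
    by (rule eventually_all_finite)
  then obtain b where b: "0 < b" "\<And>e. 0 < e \<Longrightarrow> e < b \<Longrightarrow> \<forall>j. v \<le> (transpose A *v w e) $ j"
    by (auto simp: eventually_at_right_field)
  define e where "e = min 1 b / 2"
  have e: "0 < e" "e < 1" "e < b" using b(1) by (auto simp: e_def min_def)
  have "w e \<in> prob_simplex"
    using D(1) x e by (auto simp: w_def prob_simplex_def sum.distrib sum_distrib_left[symmetric])
  then have "optimal_solution A (w e, ys)"
    using D(2,3) b(2)[of e] e by (intro optimal_solutionI[where v = v]) auto
  from uniq[OF this] have "e *\<^sub>R (x - xs) = 0" by (simp add: w_def algebra_simps)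
  with e show ?thesis by simp
qed

lemma equalizing_pair_eq:
  fixes A :: "real ^ 'm ^ 'n"
  assumes uniq: "\<And>z. optimal_solution A z \<Longrightarrow> z = (xs, ys)"
    and opt: "optimal_solution A (xs, ys)"
    and x: "x \<in> prob_simplex" and y: "y \<in> prob_simplex"
    and c: "\<And>i. 0 < x $ i \<Longrightarrow> (A *v y) $ i = c"
    and d: "\<And>j. 0 < y $ j \<Longrightarrow> (transpose A *v x) $ j = d"
    and suppx: "\<And>i. 0 < xs $ i \<Longrightarrow> 0 < x $ i"
    and suppy: "\<And>j. 0 < ys $ j \<Longrightarrow> 0 < y $ j"
  shows "x = xs \<and> y = ys"
proof
  show "x = xs" using assms by (rule equalizing_pair_eq_fst)
  show "y = ys"
  proof (rule equalizing_pair_eq_fst[where A = "- transpose A"])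
    show "\<And>z. optimal_solution (- transpose A) z \<Longrightarrow> z = (ys, xs)"
      by (rule unique_optimal_transpose[OF uniq])
    show "optimal_solution (- transpose A) (ys, xs)" using opt by (simp add: optimal_solution_transpose)
    show "(- transpose A *v x) $ j = - d" if "0 < y $ j" for j
      using d[OF that] by (simp add: uminus_matrix_vector_mult)
    show "(transpose (- transpose A) *v y) $ i = - c" if "0 < x $ i" for i
      using c[OF that] by (simp add: uminus_matrix_vector_mult transpose_uminus)
  qed (use x y suppx suppy in auto)
qed

section \<open>Compactness, limits and lower bounds on the support\<close>

lemma compact_prob_simplex: "compact (prob_simplex :: (real ^ 'k) set)"
proof -
  have "closed (prob_simplex :: (real ^ 'k) set)"
    unfolding prob_simplex_def
    by (intro closed_Collect_conj closed_Collect_all closed_Collect_le closed_Collect_eq continuous_intros)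
  moreover have "norm x \<le> 1" if "x \<in> prob_simplex" for x :: "real ^ 'k"
    using that norm_le_l1_cart[of x] by (simp add: prob_simplex_def)
  ultimately show ?thesis
    by (auto simp: compact_eq_bounded_closed intro!: boundedI)
qed

text \<open>If convergence failed, infinitely many terms would keep a fixed distance from
  \<open>l\<close>; compactness extracts from them a limit point, which has to be
  \<open>l\<close>.\<close>

lemma compact_tendstoI:
  fixes f :: "nat \<Rightarrow> 'a :: metric_space"
  assumes S: "compact S" "\<And>n. f n \<in> S"
    and lim: "\<And>r w. strict_mono r \<Longrightarrow> w \<in> S \<Longrightarrow> (f \<circ> r) \<longlonglongrightarrow> w \<Longrightarrow> w = l"
  shows "f \<longlonglongrightarrow> l"
proof (rule ccontr)
  assume "\<not> f \<longlonglongrightarrow> l"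
  then obtain e where e: "0 < e" "\<And>N. \<exists>n\<ge>N. e \<le> dist (f n) l"
    unfolding lim_sequentially by (auto simp: not_less)
  then have "infinite {n. e \<le> dist (f n) l}"
    by (auto simp: infinite_nat_iff_unbounded_le)
  then obtain s :: "nat \<Rightarrow> nat" where s: "strict_mono s" "\<And>n. e \<le> dist (f (s n)) l"
    using infinite_enumerate by blast
  have "\<forall>n. (f \<circ> s) n \<in> S" using S(2) by simp
  then obtain w r where w: "w \<in> S" "strict_mono r" "((f \<circ> s) \<circ> r) \<longlonglongrightarrow> w"
    using S(1) unfolding compact_def by metis
  then have "w = l" using lim[of "s \<circ> r" w] s(1) by (simp add: o_assoc strict_mono_o)
  with w(3) e(1) have "\<forall>\<^sub>F n in sequentially. dist (((f \<circ> s) \<circ> r) n) l < e"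
    by (blast dest: tendstoD)
  then obtain n where "dist (f (s (r n))) l < e" by (auto simp: eventually_sequentially)
  with s(2)[of "r n"] show False by simp
qed

text \<open>All terms \<open>- u $ k * ln (q $ k)\<close> are nonnegative, so a tiny
  \<open>q $ i\<close> alone would make the divergence exceed \<open>C\<close>. This keeps limits of
  the anchors positive on the support of the equilibrium.\<close>

lemma kl_bounded_support:
  assumes u: "u \<in> prob_simplex" and i: "0 < u $ i"
  shows "\<exists>\<delta>>0. \<forall>q\<in>pos_simplex. kl u q \<le> C \<longrightarrow> \<delta> \<le> q $ i"
proof -
  define H where "H = (\<Sum>k\<in>UNIV. u $ k * ln (u $ k))"
  have "exp ((H - C) / u $ i) \<le> q $ i" if q: "q \<in> pos_simplex" "kl u q \<le> C" for q
  proof -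
    have nn: "0 \<le> u $ k * (- ln (q $ k))" for k
      using u q(1) prob_simplex_le_1[OF pos_simplex_subset[OF q(1)]]
      by (intro mult_nonneg_nonneg) (auto simp: prob_simplex_def pos_simplex_def)
    have "u $ i * (- ln (q $ i)) \<le> (\<Sum>k\<in>UNIV. u $ k * (- ln (q $ k)))"
      using nn by (intro member_le_sum) auto
    also have "\<dots> = kl u q - H" by (simp add: kl_def H_def algebra_simps sum_subtractf sum_negf)
    finally have "(H - C) / u $ i \<le> ln (q $ i)" using q(2) i by (simp add: field_simps)
    then show ?thesis using q(1) by (simp add: pos_simplex_def ln_ge_iff)
  qed
  then show ?thesis by (intro exI[of _ "exp ((H - C) / u $ i)"]) auto
qed

lemma tendsto_mw:
  assumes p: "(p \<longlongrightarrow> a) F" and g: "(g \<longlongrightarrow> b) F" and a: "a \<in> prob_simplex"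
  shows "((\<lambda>n. mw (p n) (g n)) \<longlongrightarrow> mw a b) F"
proof (rule vec_tendstoI)
  fix i
  have "(\<Sum>j\<in>UNIV. a $ j * exp (b $ j)) \<noteq> 0" using mw_denominator_pos[OF a, of b] by simp
  then show "((\<lambda>n. mw (p n) (g n) $ i) \<longlongrightarrow> mw a b $ i) F"
    unfolding mw_def vec_lambda_beta using p g by (intro tendsto_intros)
qed

section \<open>Decrease of the potential and convergence at constant stepsize\<close>

text \<open>The prediction error is controlled by Cauchy-Schwarz and the Lipschitz bound. The
  opponent's move from \<open>y0\<close> to \<open>y1\<close> is routed through the opponent's
  anchor \<open>w\<close>, which expresses it by divergences that the potential can absorb.\<close>

lemma optimistic_player_step:
  fixes M :: "real ^ 'm ^ 'n"
  assumes p: "p \<in> pos_simplex" and u: "u \<in> prob_simplex"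
    and q: "q = mw p (\<eta> *\<^sub>R (M *v y0))" and r: "r = mw p (\<eta> *\<^sub>R (M *v y1))"
    and y: "y0 \<in> pos_simplex" "w \<in> pos_simplex" "y1 \<in> pos_simplex"
    and L: "\<And>y. norm (M *v y) \<le> L * norm y" and \<eta>: "0 < \<eta>" "0 \<le> L" "\<eta> * L \<le> 1 / 16"
  shows "kl u r \<le> kl u p - kl r q - kl q p - \<eta> * ((M *v y1) \<bullet> (u - q))
           + (2 * kl y1 w + 2 * kl w y0 + kl r q) / 8"
proof -
  have qr: "q \<in> pos_simplex" "r \<in> pos_simplex" unfolding q r by (rule mw_pos_simplex[OF p])+
  define s where "s = norm (y1 - y0)"
  define e where "e = norm (r - q)"
  have e: "e\<^sup>2 \<le> 4 * kl r q"
    using kl_ge_norm[OF pos_simplex_subset[OF qr(2)] qr(1)] by (simp add: e_def)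
  have "s \<le> norm (y1 - w) + norm (w - y0)"
    unfolding s_def using norm_triangle_ineq[of "y1 - w" "w - y0"] by simp
  then have "s\<^sup>2 \<le> (norm (y1 - w) + norm (w - y0))\<^sup>2" by (intro power_mono) (auto simp: s_def)
  also have "\<dots> \<le> 2 * (norm (y1 - w))\<^sup>2 + 2 * (norm (w - y0))\<^sup>2"
    using sum_squares_bound[of "norm (y1 - w)" "norm (w - y0)"] by (simp add: power2_sum)
  also have "\<dots> \<le> 8 * kl y1 w + 8 * kl w y0"
    using kl_ge_norm[OF pos_simplex_subset[OF y(3)] y(2)] kl_ge_norm[OF pos_simplex_subset[OF y(2)] y(1)]
    by simp
  finally have s: "s\<^sup>2 \<le> 8 * kl y1 w + 8 * kl w y0" .
  have "(\<eta> *\<^sub>R (M *v y1) - \<eta> *\<^sub>R (M *v y0)) \<bullet> (r - q) = \<eta> * ((M *v (y1 - y0)) \<bullet> (r - q))"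
    by (simp add: matrix_vector_mult_diff_distrib inner_simps algebra_simps)
  also have "\<dots> \<le> \<eta> * (norm (M *v (y1 - y0)) * e)"
    unfolding e_def using \<eta> by (intro mult_left_mono norm_cauchy_schwarz) auto
  also have "\<dots> \<le> \<eta> * ((L * s) * e)"
    unfolding e_def s_def using \<eta> L by (intro mult_left_mono mult_right_mono) auto
  also have "\<dots> = (\<eta> * L) * (s * e)" by simp
  \<comment> \<open>The stepsize bound enters here: \<open>s * e / 16\<close> is at most
    \<open>(s\<^sup>2 + e\<^sup>2) / 32\<close>, and the factors 8 and 4 in the bounds on
    \<open>s\<^sup>2\<close> and \<open>e\<^sup>2\<close> leave the stated eighth.\<close>
  also have "\<dots> \<le> (1 / 16) * (s * e)"
    using \<eta>(3) by (intro mult_right_mono) (auto simp: s_def e_def)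
  also have "\<dots> \<le> (s\<^sup>2 + e\<^sup>2) / 32" using sum_squares_bound[of s e] by (simp add: mult_ac)
  also have "\<dots> \<le> (2 * kl y1 w + 2 * kl w y0 + kl r q) / 8" using s e by simp
  finally have "(\<eta> *\<^sub>R (M *v y1) - \<eta> *\<^sub>R (M *v y0)) \<bullet> (r - q) \<le> (2 * kl y1 w + 2 * kl w y0 + kl r q) / 8" .
  with optimistic_step[OF p u q r] show ?thesis by simp
qed

lemma kl_nonneg: "p \<in> prob_simplex \<Longrightarrow> q \<in> pos_simplex \<Longrightarrow> 0 \<le> kl p q"
  using kl_ge_norm[of p q] zero_le_power2[of "norm (p - q)"] by linarith

lemma kl_tendsto_0_imp:
  assumes "(\<lambda>n. kl (p n) (q n)) \<longlonglongrightarrow> 0" "\<And>n. p n \<in> pos_simplex" "\<And>n. q n \<in> pos_simplex"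
  shows "(\<lambda>n. p n - q n) \<longlonglongrightarrow> 0"
proof -
  have "(\<lambda>n. (norm (p n - q n))\<^sup>2) \<longlonglongrightarrow> 0"
  proof (rule tendsto_sandwich[OF _ _ tendsto_const])
    show "(\<lambda>n. 4 * kl (p n) (q n)) \<longlonglongrightarrow> 0" using tendsto_mult_right_zero[OF assms(1)] .
    show "\<forall>\<^sub>F n in sequentially. (norm (p n - q n))\<^sup>2 \<le> 4 * kl (p n) (q n)"
      using kl_ge_norm[OF pos_simplex_subset[OF assms(2)] assms(3)] by (auto intro!: always_eventually simp: field_simps)
  qed auto
  from tendsto_real_sqrt[OF this] show ?thesis by (simp add: tendsto_norm_zero_iff)
qed

text \<open>With \<open>B\<close> as the column player's payoff matrix, both players maximise and
  their recursions have the same form.\<close>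

lemma constant_step_omwu_converges:
  fixes A :: "real ^ 'm ^ 'n" and X :: "nat \<Rightarrow> real ^ 'n" and Y :: "nat \<Rightarrow> real ^ 'm"
  defines "B \<equiv> - transpose A"
  assumes uniq: "\<And>z. optimal_solution A z \<Longrightarrow> z = (xs, ys)"
    and opt: "optimal_solution A (xs, ys)"
    and LA: "\<And>y. norm (A *v y) \<le> L * norm y" and LB: "\<And>x. norm (B *v x) \<le> L * norm x"
    and \<eta>: "0 < \<eta>" "0 \<le> L" "\<eta> * L \<le> 1 / 16"
    and init: "X 0 \<in> pos_simplex" "Y 0 \<in> pos_simplex" "X 1 \<in> pos_simplex" "Y 1 \<in> pos_simplex"
    and recX: "\<And>t. X (Suc (Suc t)) = mw (X (Suc t)) ((2 * \<eta>) *\<^sub>R (A *v Y (Suc t)) - \<eta> *\<^sub>R (A *v Y t))"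
    and recY: "\<And>t. Y (Suc (Suc t)) = mw (Y (Suc t)) ((2 * \<eta>) *\<^sub>R (B *v X (Suc t)) - \<eta> *\<^sub>R (B *v X t))"
  shows "X \<longlonglongrightarrow> xs" "Y \<longlonglongrightarrow> ys"
proof -
  note D = optimal_solutionD[OF opt]
  have pos: "X t \<in> pos_simplex \<and> Y t \<in> pos_simplex" for t
  proof (induction t rule: induct_nat_012)
    case (ge2 t)
    then show ?case unfolding recX recY by (auto intro: mw_pos_simplex)
  qed (use init in auto)
  then have posX: "X t \<in> pos_simplex" and posY: "Y t \<in> pos_simplex" for t by auto
  \<comment> \<open>The anchor undoes the predicted step that led to \<open>X (Suc t)\<close>. In
    the next exponent the old prediction thus disappears, and consecutive anchors differ by a step
    along the current gradient alone.\<close>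
  define U where "U = (\<lambda>t. mw (X (Suc t)) (- \<eta> *\<^sub>R (A *v Y t)))"
  define V where "V = (\<lambda>t. mw (Y (Suc t)) (- \<eta> *\<^sub>R (B *v X t)))"
  have posU: "U t \<in> pos_simplex" and posV: "V t \<in> pos_simplex" for t
    unfolding U_def V_def by (auto intro: mw_pos_simplex posX posY)
  have XU: "X (Suc t) = mw (U t) (\<eta> *\<^sub>R (A *v Y t))" for t
    by (simp add: U_def mw_mw[OF posX] mw_0[OF posX])
  have YV: "Y (Suc t) = mw (V t) (\<eta> *\<^sub>R (B *v X t))" for t
    by (simp add: V_def mw_mw[OF posY] mw_0[OF posY])
  have US: "U (Suc t) = mw (U t) (\<eta> *\<^sub>R (A *v Y (Suc t)))" for t
    unfolding U_def recX mw_mw[OF posX] by (rule arg_cong[of _ _ "mw _"]) (simp add: vec_eq_iff)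
  have VS: "V (Suc t) = mw (V t) (\<eta> *\<^sub>R (B *v X (Suc t)))" for t
    unfolding V_def recY mw_mw[OF posY] by (rule arg_cong[of _ _ "mw _"]) (simp add: vec_eq_iff)
  define a where "a = (\<lambda>t. kl (U t) (X t) + kl (V t) (Y t))"
  define b where "b = (\<lambda>t. kl (X (Suc t)) (U t) + kl (Y (Suc t)) (V t))"
  \<comment> \<open>Half of \<open>a t\<close> is stored in the potential, since the prediction
    errors of the next step cost \<open>a t / 4\<close>.\<close>
  define \<Phi> where "\<Phi> = (\<lambda>t. kl xs (U t) + kl ys (V t) + a t / 2)"
  note nonneg = kl_nonneg[OF D(1) posU] kl_nonneg[OF D(2) posV]
    kl_nonneg[OF pos_simplex_subset[OF posU] posX] kl_nonneg[OF pos_simplex_subset[OF posV] posY]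
    kl_nonneg[OF pos_simplex_subset[OF posX] posU] kl_nonneg[OF pos_simplex_subset[OF posY] posV]
  have ab: "0 \<le> a t" "0 \<le> b t" for t
    unfolding a_def b_def by (auto intro: add_nonneg_nonneg nonneg)
  \<comment> \<open>Adding both players' inequalities gives a decrease of at least
    \<open>a t / 4 + 3 * b t / 4 + 3 * a (Suc t) / 8\<close>.\<close>
  have descent: "\<Phi> (Suc t) \<le> \<Phi> t - (a t + b t) / 4" for t
  proof -
    \<comment> \<open>The terms \<open>x \<bullet> (A *v y)\<close> of the two players cancel,
      leaving \<open>xs \<bullet> (A *v y) - x \<bullet> (A *v ys)\<close>, which is nonnegative by
      the saddle point property.\<close>
    have "0 \<le> (A *v y) \<bullet> (xs - x) + (B *v x) \<bullet> (ys - y)"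
      if "x \<in> prob_simplex" "y \<in> prob_simplex" for x y
    proof -
      have "x \<bullet> (A *v ys) \<le> xs \<bullet> (A *v y)"
        using simplex_inner_le[OF that(1) D(3)] simplex_inner_ge[OF that(2) D(4)]
        by (simp only: inner_matrix_transpose[of xs A y])
      moreover have "(B *v x) \<bullet> z = - (x \<bullet> (A *v z))" for z
        by (simp add: B_def uminus_matrix_vector_mult inner_matrix_transpose[of x A z] inner_commute[of z]
            del: transpose_matrix_vector)
      ultimately show ?thesis
        by (simp add: inner_commute[of "A *v y"] inner_diff_left inner_diff_right matrix_vector_mult_diff_distrib)
    qed
    from this[of "X (Suc t)" "Y (Suc t)"]
    have "0 \<le> \<eta> * ((A *v Y (Suc t)) \<bullet> (xs - X (Suc t))) + \<eta> * ((B *v X (Suc t)) \<bullet> (ys - Y (Suc t)))"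
      using \<eta>(1) posX posY by (simp add: pos_simplex_subset distrib_left[symmetric])
    with optimistic_player_step[OF posU[of t] D(1) XU US posY posV[of t] posY LA \<eta>]
      optimistic_player_step[OF posV[of t] D(2) YV VS posX posU[of t] posX LB \<eta>] ab[of t] ab(1)[of "Suc t"]
    show ?thesis unfolding \<Phi>_def a_def b_def by argo
  qed
  have \<Phi>0: "0 \<le> \<Phi> t" for t
    unfolding \<Phi>_def using nonneg(1,2)[of t] ab(1)[of t] by linarith
  have dec: "decseq \<Phi>"
    using descent ab by (intro decseq_SucI) (smt (verit) divide_nonneg_nonneg)
  then obtain l where l: "\<Phi> \<longlonglongrightarrow> l"
    using decseq_convergent[of \<Phi> 0] \<Phi>0 by blast
  have diff: "(\<lambda>t. 4 * (\<Phi> t - \<Phi> (Suc t))) \<longlonglongrightarrow> 0"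
    using tendsto_mult_right_zero[OF tendsto_diff[OF l LIMSEQ_Suc[OF l], simplified]] .
  \<comment> \<open>Decrements of a convergent sequence vanish, and four times the decrement
    dominates \<open>a t + b t\<close>.\<close>
  have small: "f \<longlonglongrightarrow> 0" if "\<And>t. 0 \<le> f t" "\<And>t. f t \<le> a t + b t" for f
  proof (rule tendsto_sandwich[OF _ _ tendsto_const diff])
    have "f t \<le> 4 * (\<Phi> t - \<Phi> (Suc t))" for t
      using that(2)[of t] descent[of t] by argo
    then show "\<forall>\<^sub>F t in sequentially. f t \<le> 4 * (\<Phi> t - \<Phi> (Suc t))" by simp
  qed (use that in auto)
  have lims: "(\<lambda>t. U t - X t) \<longlonglongrightarrow> 0" "(\<lambda>t. V t - Y t) \<longlonglongrightarrow> 0"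
    "(\<lambda>t. X (Suc t) - U t) \<longlonglongrightarrow> 0" "(\<lambda>t. Y (Suc t) - V t) \<longlonglongrightarrow> 0"
    using nonneg
    by (auto intro!: kl_tendsto_0_imp small posX posY posU posV simp: a_def b_def add_increasing add_increasing2)
  have le_\<Phi>: "kl xs (U t) \<le> \<Phi> 0" "kl ys (V t) \<le> \<Phi> 0" for t
    using nonneg(1,2)[of t] ab(1)[of t] decseqD[OF dec, of 0 t] by (auto simp: \<Phi>_def)
  have "(\<lambda>t. (U t, V t)) \<longlonglongrightarrow> (xs, ys)"
  proof (rule compact_tendstoI)
    show "compact (prob_simplex \<times> prob_simplex :: ((real ^ 'n) \<times> (real ^ 'm)) set)"
      by (intro compact_Times compact_prob_simplex)
    show "(U t, V t) \<in> prob_simplex \<times> prob_simplex" for t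
      by (simp add: pos_simplex_subset posU posV)
    fix r :: "nat \<Rightarrow> nat" and w :: "(real ^ 'n) \<times> (real ^ 'm)"
    assume r: "strict_mono r" and w: "w \<in> prob_simplex \<times> prob_simplex"
      and lim: "((\<lambda>t. (U t, V t)) \<circ> r) \<longlonglongrightarrow> w"
    obtain x y where wxy: "w = (x, y)" by fastforce
    then have x: "x \<in> prob_simplex" and y: "y \<in> prob_simplex" using w by auto
    have Ux: "(\<lambda>n. U (r n)) \<longlonglongrightarrow> x" and Vy: "(\<lambda>n. V (r n)) \<longlonglongrightarrow> y"
      using tendsto_fst[OF lim] tendsto_snd[OF lim] by (auto simp: wxy o_def)
    have sub: "(\<lambda>n. f (r n)) \<longlonglongrightarrow> c" if "f \<longlonglongrightarrow> c" for f :: "nat \<Rightarrow> 'z::real_normed_vector" and c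
      using LIMSEQ_subseq_LIMSEQ[OF that r] by (simp add: o_def)
    have Xx: "(\<lambda>n. X (Suc (r n))) \<longlonglongrightarrow> x"
      using tendsto_add[OF sub[OF lims(3)] Ux] by simp
    have Yy: "(\<lambda>n. Y (Suc (r n))) \<longlonglongrightarrow> y"
      using tendsto_add[OF sub[OF lims(4)] Vy] by simp
    have USx: "(\<lambda>n. U (Suc (r n))) \<longlonglongrightarrow> x"
      using tendsto_add[OF sub[OF LIMSEQ_Suc[OF lims(1)]] Xx] by simp
    have VSy: "(\<lambda>n. V (Suc (r n))) \<longlonglongrightarrow> y"
      using tendsto_add[OF sub[OF LIMSEQ_Suc[OF lims(2)]] Yy] by simp
    \<comment> \<open>Anchors at \<open>r n\<close> and \<open>Suc (r n)\<close> share their limit,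
      so passing to the limit in the anchor recursion yields a fixed point.\<close>
    have "(\<lambda>n. U (Suc (r n))) \<longlonglongrightarrow> mw x (\<eta> *\<^sub>R (A *v y))"
      unfolding US using Ux Yy x
      by (intro tendsto_mw tendsto_scaleR tendsto_const bounded_linear.tendsto[OF matrix_vector_mul_bounded_linear])
    with USx have fx: "mw x (\<eta> *\<^sub>R (A *v y)) = x" using LIMSEQ_unique by blast
    have "(\<lambda>n. V (Suc (r n))) \<longlonglongrightarrow> mw y (\<eta> *\<^sub>R (B *v x))"
      unfolding VS using Vy Xx y
      by (intro tendsto_mw tendsto_scaleR tendsto_const bounded_linear.tendsto[OF matrix_vector_mul_bounded_linear])
    with VSy have fy: "mw y (\<eta> *\<^sub>R (B *v x)) = y" using LIMSEQ_unique by blast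
    obtain c where c: "\<And>i. 0 < x $ i \<Longrightarrow> \<eta> * (A *v y) $ i = c"
      using mw_fixed_point[OF x fx] by auto
    obtain d where d: "\<And>j. 0 < y $ j \<Longrightarrow> \<eta> * (B *v x) $ j = d"
      using mw_fixed_point[OF y fy] by auto
    have supp: "0 < q $ i" if u: "u \<in> prob_simplex" "0 < u $ i" and W: "\<And>t. W t \<in> pos_simplex"
        "\<And>t. kl u (W t) \<le> \<Phi> 0" "(\<lambda>n. W (r n)) \<longlonglongrightarrow> q" for u q :: "real ^ 'k" and W i
    proof -
      obtain \<delta> where "0 < \<delta>" "\<And>t. \<delta> \<le> W t $ i"
        using kl_bounded_support[OF u, of "\<Phi> 0"] W(1,2) by blast
      moreover have "(\<lambda>n. W (r n) $ i) \<longlonglongrightarrow> q $ i" using W(3) by (rule tendsto_vec_nth)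
      ultimately show ?thesis
        by (meson LIMSEQ_le_const less_le_trans)
    qed
    have "x = xs \<and> y = ys"
    proof (rule equalizing_pair_eq[OF uniq opt x y])
      show "(A *v y) $ i = c / \<eta>" if "0 < x $ i" for i
        using c[OF that] \<eta>(1) by (simp add: field_simps)
      show "(transpose A *v x) $ j = - d / \<eta>" if "0 < y $ j" for j
        using d[OF that] \<eta>(1)
        by (simp add: B_def uminus_matrix_vector_mult field_simps del: transpose_matrix_vector)
      show "0 < x $ i" if "0 < xs $ i" for i
        using D(1) that posU le_\<Phi>(1) Ux by (rule supp)
      show "0 < y $ j" if "0 < ys $ j" for j
        using D(2) that posV le_\<Phi>(2) Vy by (rule supp)
    qed
    then show "w = (xs, ys)" by (simp add: wxy)
  qed
  then have UV: "U \<longlonglongrightarrow> xs" "V \<longlonglongrightarrow> ys"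
    using tendsto_fst[of _ "(xs, ys)"] tendsto_snd[of _ "(xs, ys)"] by fastforce+
  show "X \<longlonglongrightarrow> xs" using tendsto_diff[OF UV(1) lims(1)] by simp
  show "Y \<longlonglongrightarrow> ys" using tendsto_diff[OF UV(2) lims(2)] by simp
qed

section \<open>Application to OMWU with uniform initialization\<close>

lemma omwu_x_eq_mw:
  "omwu_x \<eta> A x y y' = mw x ((2 * \<eta>) *\<^sub>R (A *v y) - \<eta> *\<^sub>R (A *v y'))"
  by (simp add: omwu_x_def mw_def)

lemma omwu_y_eq_mw:
  "omwu_y \<eta> A y x x' = mw y ((2 * \<eta>) *\<^sub>R ((- transpose A) *v x) - \<eta> *\<^sub>R ((- transpose A) *v x'))"
  by (simp add: omwu_y_def mw_def uminus_matrix_vector_mult del: transpose_matrix_vector)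

lemma uniform_dist_pos_simplex: "(uniform_dist :: real ^ 'k) \<in> pos_simplex"
  by (simp add: uniform_dist_def pos_simplex_def)

theorem theorem1p1:
  fixes A :: "real ^ 'm ^ 'n" and xs :: "real ^ 'n" and ys :: "real ^ 'm"
  assumes "\<exists>!z. optimal_solution A z"
    and "optimal_solution A (xs, ys)"
  shows "\<exists>\<epsilon>2. 0 < \<epsilon>2 \<and> \<epsilon>2 \<le> 1 \<and> (\<forall>\<eta>2. 0 < \<eta>2 \<and> \<eta>2 < \<epsilon>2 \<longrightarrow>
           (\<exists>\<epsilon>1. 0 < \<epsilon>1 \<and> \<epsilon>1 \<le> 1 \<and> (\<forall>\<eta>1. 0 < \<eta>1 \<and> \<eta>1 < \<epsilon>1 \<longrightarrow>
              (\<exists>T\<ge>1. (\<lambda>t. omwu (two_phase T \<eta>1 \<eta>2) A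
                 (uniform_dist, uniform_dist) (uniform_dist, uniform_dist) t)
                 \<longlonglongrightarrow> (xs, ys)))))"
proof -
  have uniq: "\<And>z. optimal_solution A z \<Longrightarrow> z = (xs, ys)" using assms by blast
  obtain K1 where K1: "\<And>y. norm (A *v y) \<le> norm y * K1"
    using bounded_linear.bounded[OF matrix_vector_mul_bounded_linear[of A]] by blast
  obtain K2 where K2: "\<And>x. norm ((- transpose A) *v x) \<le> norm x * K2"
    using bounded_linear.bounded[OF matrix_vector_mul_bounded_linear[of "- transpose A"]] by blast
  \<comment> \<open>A common Lipschitz constant for both players; being at least 1, it also keeps
    the threshold \<open>1 / (16 * L)\<close> below 1.\<close>
  define L where "L = max 1 (max K1 K2)"
  have L: "1 \<le> L" "K1 \<le> L" "K2 \<le> L" by (auto simp: L_def)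
  have LA: "norm (A *v y) \<le> L * norm y" for y
    using K1[of y] mult_right_mono[OF L(2), of "norm y"] by (simp add: mult.commute)
  have LB: "norm ((- transpose A) *v x) \<le> L * norm x" for x
    using K2[of x] mult_right_mono[OF L(3), of "norm x"] by (simp add: mult.commute)
  have main: "(\<lambda>t. omwu (two_phase 1 \<eta>1 \<eta>2) A
      (uniform_dist, uniform_dist) (uniform_dist, uniform_dist) t) \<longlonglongrightarrow> (xs, ys)"
    if \<eta>: "0 < \<eta>2" "\<eta>2 < 1 / (16 * L)" for \<eta>1 \<eta>2
  proof -
    define Z where "Z = omwu (two_phase 1 \<eta>1 \<eta>2) A (uniform_dist, uniform_dist) (uniform_dist, uniform_dist)"
    \<comment> \<open>Time is shifted by one: \<open>X 0\<close> is the iterate at time 1, and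
      \<open>X 1\<close> results from the only step with rate \<open>\<eta>1\<close>. All later
      steps start at time 2 or later, beyond \<open>T = 1\<close>, and use
      \<open>\<eta>2\<close>.\<close>
    define X where "X = (\<lambda>t. fst (Z (Suc t)))"
    define Y where "Y = (\<lambda>t. snd (Z (Suc t)))"
    have "\<eta>2 * L \<le> 1 / 16" using \<eta> L(1) by (simp add: field_simps)
    moreover have "X 0 \<in> pos_simplex" "Y 0 \<in> pos_simplex" "X 1 \<in> pos_simplex" "Y 1 \<in> pos_simplex"
      by (simp_all add: X_def Y_def Z_def omwu_x_eq_mw omwu_y_eq_mw uniform_dist_pos_simplex mw_pos_simplex)
    moreover have "X (Suc (Suc t)) = mw (X (Suc t)) ((2 * \<eta>2) *\<^sub>R (A *v Y (Suc t)) - \<eta>2 *\<^sub>R (A *v Y t))" for t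
      unfolding X_def Y_def Z_def omwu.simps(3)[of _ _ _ _ "Suc t"]
      by (simp add: omwu_x_eq_mw case_prod_unfold Let_def two_phase_def del: omwu.simps(3))
    moreover have "Y (Suc (Suc t)) = mw (Y (Suc t))
        ((2 * \<eta>2) *\<^sub>R ((- transpose A) *v X (Suc t)) - \<eta>2 *\<^sub>R ((- transpose A) *v X t))" for t
      unfolding X_def Y_def Z_def omwu.simps(3)[of _ _ _ _ "Suc t"]
      by (simp add: omwu_y_eq_mw case_prod_unfold Let_def two_phase_def del: omwu.simps(3))
    ultimately have "X \<longlonglongrightarrow> xs" "Y \<longlonglongrightarrow> ys"
      using constant_step_omwu_converges[OF uniq assms(2) LA LB \<eta>(1), of X Y] L(1) by auto
    then have "(\<lambda>t. (X t, Y t)) \<longlonglongrightarrow> (xs, ys)" by (rule tendsto_Pair)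
    then have "(\<lambda>t. Z (Suc t)) \<longlonglongrightarrow> (xs, ys)" by (simp add: X_def Y_def)
    then show ?thesis unfolding Z_def by (rule LIMSEQ_imp_Suc)
  qed
  have "0 < 1 / (16 * L)" "1 / (16 * L) \<le> 1" using L(1) by (auto simp: field_simps)
  then show ?thesis
    using main by (intro exI[of _ "1 / (16 * L)"] conjI allI impI exI[of _ 1]) auto
qed

end
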